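(* Let $\mathcal{P}$ be the set of integer partitions satisfying all of the following: (i) no part repeats; (ii) adjacent parts do not differ by $1$ if the larger of the two is even; (iii) for every integer $j$, none of $(2j)+(2j+1)+(2j+3)$, $(2j)+(2j+2)+(2j+3)$, $(2j)+(2j+2)+(2j+4)$ occurs as a sub-partition. Then, as formal power series in $x,q$, writing $N=i+2j+3k$, $$\sum_{\pi\in\mathcal{P}}x^{\ell(\pi)}q^{|\pi|}=\sum_{i,j,k\ge 0}(-1)^k\frac{x^{N}q^{N(N-1)+i+3j+3k^2+3k}}{(q;q)_i\,(q^4;q^4)_j\,(q^6;q^6)_k}.$$
   Context: Partitions are finite weakly increasing sequences of positive integers (the empty partition is included); $\ell(\pi)$ is the number of parts and $|\pi|$ the sum of the parts of $\pi$. A sub-partition of a partition is a contiguous portion of it. For $n\ge 0$, $(a;q)_n=\prod_{0\le t<n}(1-aq^t)$. All identities are identities of formal power series. *)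

theory Defs
  imports
    "HOL-Analysis.Analysis"
    "HOL-Library.Sublist"
    "HOL-Computational_Algebra.Formal_Power_Series"
begin

(* Partitions are weakly increasing lists of positive integers, the empty list included. *)
definition is_partition :: "nat list \<Rightarrow> bool" where
  "is_partition \<pi> \<longleftrightarrow> sorted \<pi> \<and> (\<forall>p\<in>set \<pi>. 0 < p)"

(* Parts are listed in increasing order, so in an adjacent pair the later entry is the larger
   one; sublist is the contiguous-sublist relation. *)
definition partitions_P :: "nat list set" where
  "partitions_P = {\<pi>. is_partition \<pi> \<and>
     distinct \<pi> \<and>
     (\<forall>a b. sublist [a, b] \<pi> \<and> even b \<longrightarrow> b \<noteq> a + 1) \<and>
     (\<forall>j::int.
        \<not> sublist [2 * j, 2 * j + 1, 2 * j + 3] (map int \<pi>) \<and>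
        \<not> sublist [2 * j, 2 * j + 2, 2 * j + 3] (map int \<pi>) \<and>
        \<not> sublist [2 * j, 2 * j + 2, 2 * j + 4] (map int \<pi>))}"

definition qpoch :: "'a::comm_ring_1 \<Rightarrow> 'a \<Rightarrow> nat \<Rightarrow> 'a" where
  "qpoch a q n = (\<Prod>t<n. 1 - a * q ^ t)"

(* Formal power series in x and q are power series in q whose coefficients are power series in x.
   The library topology on this ring is the q-adic one; since there are finitely many partitions
   of each size, sums over partitions converge in it. *)
definition qvar :: "rat fps fps" where
  "qvar = fps_X"

definition xvar :: "rat fps fps" where
  "xvar = fps_const fps_X"

(* The library proves its cancellation laws for division of power series over a field only; here
   the coefficients are rat fps, where division by series with constant term 1 is still exact. *)
lemma fps_divide_times_cancel:
  fixes f g :: "rat fps fps"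
  assumes "fps_nth g 0 = 1"
  shows "f / g * g = f"
proof -
  have sd: "subdegree g = 0"
    using assms by (auto intro: subdegree_eq_0)
  have "inverse (fps_nth g 0) = 1"
    using assms by (simp add: fps_inverse_one')
  then have "g * inverse g = 1"
    unfolding fps_inverse_def using assms by (intro fps_right_inverse) simp
  then show ?thesis
    using sd by (simp add: fps_divide_def mult.assoc mult.commute)
qed

lemma qpoch_nth_0:
  assumes "m > 0"
  shows "fps_nth (qpoch (qvar ^ m) (qvar ^ m) n) 0 = 1"
  using assms by (induction n) (simp_all add: qpoch_def qvar_def fps_mult_nth_0)

end

(* Splitting the partitions in P according to the parts below 4 shows that their generating
   function f(x) satisfies f(x) = g(x) + x q f(x q^2) and
     g(x) = g(x q^2) + x (q^2 + q^3) f(x q^4) + x^2 q^5 g(x q^4) + x^2 q^6 f(x q^6),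
   where g counts those with all parts at least 2. Eliminating g gives a linear q-difference
   equation of order 3, which has only one solution with constant term 1.
   Without the factors q^(N(N-1)), the triple sum is a product H(x) of three Euler series, and
     (1 - x q) (1 - x q^2) (1 - x^2 q^3) H(x) = (1 - x^3 q^6) H(x q^2).
   The right-hand side contains 1 - x q^2 as a factor; cancelling it and inserting the factors
   q^(N(N-1)) again turns this into the equation for f. *)

theory Submission
  imports Defs
begin

section \<open>Dilations and the functional equation\<close>

definition dilate :: "'a::idom \<Rightarrow> 'a fps \<Rightarrow> 'a fps" where
  "dilate c f = f oo (fps_const c * fps_X)"

lemma dilate_nth [simp]: "fps_nth (dilate c f) n = c ^ n * fps_nth f n"
  by (simp add: dilate_def)

lemma dilate_add: "dilate c (f + g) = dilate c f + dilate c g"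
  by (simp add: fps_eq_iff algebra_simps)

lemma dilate_diff: "dilate c (f - g) = dilate c f - dilate c g"
  by (simp add: fps_eq_iff algebra_simps)

lemma dilate_mult: "dilate c (f * g) = dilate c f * dilate c g"
  by (simp add: dilate_def fps_compose_mult_distrib)

lemma dilate_const [simp]: "dilate c (fps_const a) = fps_const a"
  by (simp add: dilate_def)

lemma dilate_X [simp]: "dilate c fps_X = fps_const c * fps_X"
  by (simp add: dilate_def)

lemma dilate_1 [simp]: "dilate c 1 = 1"
  by (simp add: dilate_def)

lemma dilate_power: "dilate c (f ^ n) = dilate c f ^ n"
  by (induction n) (simp_all add: dilate_mult)

lemma dilate_dilate: "dilate c (dilate d f) = dilate (c * d) f"
  by (simp add: fps_eq_iff power_mult_distrib algebra_simps)

text \<open>Here a series in \<open>rat fps fps\<close> has \<open>x\<close> as its outer and \<open>q\<close> as its inner variable, the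
  reverse of the convention of \<open>xvar\<close> and \<open>qvar\<close>; \<open>shift\<close> is the substitution \<open>x := x q^2\<close>.\<close>

abbreviation q :: "rat fps" where "q \<equiv> fps_X"

abbreviation Q :: "nat \<Rightarrow> rat fps fps" where "Q k \<equiv> fps_const (q ^ k)"

lemma Q_mult: "Q a * Q b = Q (a + b)"
  by (simp add: power_add)

abbreviation shift :: "rat fps fps \<Rightarrow> rat fps fps" where "shift \<equiv> dilate (q ^ 2)"

lemmas shift_simps = dilate_add dilate_diff dilate_mult dilate_power

text \<open>f(x) = (1 + x q) f(x q^2) + (x q^2 + x^2 q^5) f(x q^4) + (x^2 q^6 - x^3 q^10) f(x q^6),
  the equation left after the elimination of g, grouped by powers of x for the comparison of
  coefficients.\<close>

definition fun_eq :: "rat fps fps \<Rightarrow> bool" where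
  "fun_eq f \<longleftrightarrow> f = shift f + fps_X * (Q 1 * shift f + Q 2 * shift (shift f)) +
     fps_X ^ 2 * (Q 5 * shift (shift f) + Q 6 * shift (shift (shift f))) -
     fps_X ^ 3 * (Q 10 * shift (shift (shift f)))"

lemma one_minus_q_power_nonzero:
  assumes "n > 0"
  shows "1 - q ^ n \<noteq> 0"
proof -
  have "fps_nth (1 - q ^ n) 0 = 1"
    using assms by (simp add: fps_X_power_nth)
  then show ?thesis by (metis fps_zero_nth zero_neq_one)
qed

text \<open>At x^n the term \<open>shift f\<close> contributes q^(2n) times the n-th coefficient;
  every other term carries a factor x and sees lower coefficients only. Since 1 - q^(2n) is nonzero
  for n > 0, the constant term determines the rest.\<close>

lemma fun_eq_unique:
  assumes "fun_eq f" "fun_eq g" "fps_nth f 0 = fps_nth g 0"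
  shows "f = g"
proof (rule fps_ext)
  fix n
  show "fps_nth f n = fps_nth g n"
  proof (induction n rule: less_induct)
    case (less n)
    show ?case
    proof (cases "n = 0")
      case False
      define R where "R h = fps_X ^ 1 * (Q 1 * shift h + Q 2 * shift (shift h)) +
        fps_X ^ 2 * (Q 5 * shift (shift h) + Q 6 * shift (shift (shift h))) -
        fps_X ^ 3 * (Q 10 * shift (shift (shift h)))" for h
      have R: "fps_nth (R f) n = fps_nth (R g) n"
        using less[of "n - 1"] less[of "n - 2"] less[of "n - 3"] less[of 0] False
        unfolding R_def fps_add_nth fps_sub_nth fps_X_power_mult_nth by simp
      have eq: "(1 - q ^ (2 * n)) * fps_nth h n = fps_nth (R h) n" if "fun_eq h" for h
      proof -
        have "h = shift h + R h"
          using that unfolding fun_eq_def R_def by (simp add: add_diff_eq add.assoc)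
        from arg_cong[OF this, of "\<lambda>u. fps_nth u n"]
        have "fps_nth h n = q ^ (2 * n) * fps_nth h n + fps_nth (R h) n"
          by (simp add: power_mult)
        then show ?thesis by (simp add: algebra_simps)
      qed
      from R eq[OF assms(1)] eq[OF assms(2)]
      have "(1 - q ^ (2 * n)) * fps_nth f n = (1 - q ^ (2 * n)) * fps_nth g n" by simp
      with one_minus_q_power_nonzero[of "2 * n"] False show ?thesis by simp
    qed (use assms in simp)
  qed
qed

section \<open>The product side\<close>

text \<open>Restores the factor q^(N (N - 1)), N being the exponent of x; without this factor the
  triple sum is a product of three one-index series.\<close>

definition twist :: "rat fps fps \<Rightarrow> rat fps fps" where
  "twist f = Abs_fps (\<lambda>n. q ^ (n * (n - 1)) * fps_nth f n)"

lemma twist_add: "twist (f + g) = twist f + twist g"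
  by (simp add: twist_def fps_eq_iff algebra_simps)

lemma twist_diff: "twist (f - g) = twist f - twist g"
  by (simp add: twist_def fps_eq_iff algebra_simps)

lemma twist_const_mult: "twist (fps_const c * f) = fps_const c * twist f"
  by (simp add: twist_def fps_eq_iff algebra_simps)

lemma twist_dilate: "twist (dilate c f) = dilate c (twist f)"
  by (simp add: twist_def fps_eq_iff algebra_simps)

text \<open>The coefficient factor \<open>q^(N (N - 1))\<close> of the sum turns multiplication by \<open>x\<close> into
  \<open>f \<mapsto> x f(x q^2)\<close>, because \<open>N (N - 1) = 2 (N - 1) + (N - 1) (N - 2)\<close>.\<close>

lemma twist_X_mult: "twist (fps_X * f) = fps_X * shift (twist f)"
proof (rule fps_ext)
  fix n
  show "fps_nth (twist (fps_X * f)) n = fps_nth (fps_X * shift (twist f)) n"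
  proof (cases n)
    case (Suc m)
    have "Suc m * m = 2 * m + m * (m - 1)"
      by (cases m) (simp_all add: algebra_simps)
    then have "q ^ (Suc m * m) = (q ^ 2) ^ m * q ^ (m * (m - 1))"
      by (simp only: power_add power_mult)
    then show ?thesis using Suc by (simp add: twist_def mult.assoc del: mult_Suc)
  qed (simp add: twist_def)
qed

text \<open>By \<open>twist_X_mult\<close>, x^a h turns into q^(a (a - 1)) x^a times the a-fold
  shift of \<open>twist h\<close>. This raises the coefficients q^3 and q^4 at x^2 to q^5 and q^6,
  and q^4 at x^3 to q^10.\<close>

lemma fun_eq_twist:
  assumes "(1 - Q 1 * fps_X) * (1 - Q 3 * fps_X ^ 2) * f =
           (1 + Q 2 * fps_X + Q 4 * fps_X ^ 2) * shift f"
  shows "fun_eq (twist f)"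
proof -
  have Q4: "Q 1 * Q 3 = Q 4" by (simp only: Q_mult) simp
  \<comment> \<open>The assumption multiplied out, with powers of x as nested single factors so that
    \<open>twist_X_mult\<close> treats them one at a time.\<close>
  have "f = shift f + fps_X * (Q 1 * f) + fps_X * (Q 2 * shift f) + fps_X * (fps_X * (Q 3 * f))
     + fps_X * (fps_X * (Q 4 * shift f)) - fps_X * (fps_X * (fps_X * (Q 4 * f)))"
    using assms Q4 by algebra
  from arg_cong[OF this, of twist]
  have *: "twist f = shift (twist f) + fps_X * (Q 1 * shift (twist f))
     + fps_X * (Q 2 * shift (shift (twist f)))
     + fps_X * (Q 2 * fps_X * (Q 3 * shift (shift (twist f))))
     + fps_X * (Q 2 * fps_X * (Q 4 * shift (shift (shift (twist f)))))
     - fps_X * (Q 2 * fps_X * (Q 2 * (Q 2 * fps_X) * (Q 4 * shift (shift (shift (twist f))))))"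
    by (simp only: twist_add twist_diff twist_const_mult twist_dilate twist_X_mult
        dilate_mult dilate_const dilate_X mult.assoc)
  have c: "Q 2 * Q 3 = Q 5" "Q 2 * Q 4 = Q 6" "Q 2 * (Q 2 * (Q 2 * Q 4)) = Q 10"
    by (simp_all only: Q_mult) simp_all
  show ?thesis
    unfolding fun_eq_def using * c by algebra
qed

section \<open>Series in powers of x^d and their coefficient recurrences\<close>

definition spread :: "nat \<Rightarrow> (nat \<Rightarrow> 'a) \<Rightarrow> 'a::comm_ring_1 fps" where
  "spread d u = Abs_fps (\<lambda>n. if d dvd n then u (n div d) else 0)"

lemma spread_1 [simp]: "spread (Suc 0) u = Abs_fps u"
  by (simp add: spread_def)

lemma mult_spread_nth:
  assumes "d > 0"
  shows "fps_nth (f * spread d u) n = (\<Sum>j | d * j \<le> n. fps_nth f (n - d * j) * u j)"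
proof -
  have "fps_nth (f * spread d u) n = (\<Sum>i=0..n. fps_nth f (n - i) * fps_nth (spread d u) i)"
    unfolding mult.commute[of f] fps_mult_nth by (rule sum.cong[OF refl]) (rule mult.commute)
  also have "\<dots> = (\<Sum>i\<in>(*) d ` {j. d * j \<le> n}. fps_nth f (n - i) * fps_nth (spread d u) i)"
  proof (rule sum.mono_neutral_right)
    show "\<forall>i\<in>{0..n} - (*) d ` {j. d * j \<le> n}. fps_nth f (n - i) * fps_nth (spread d u) i = 0"
    proof
      fix i assume i: "i \<in> {0..n} - (*) d ` {j. d * j \<le> n}"
      then have "\<not> d dvd i" by (auto simp: dvd_def)
      then show "fps_nth f (n - i) * fps_nth (spread d u) i = 0" by (simp add: spread_def)
    qed
  qed auto
  also have "\<dots> = (\<Sum>j | d * j \<le> n. fps_nth f (n - d * j) * u j)"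
  proof (subst sum.reindex)
    show "inj_on ((*) d) {j. d * j \<le> n}" using assms by (intro inj_onI) simp
  qed (use assms in \<open>simp add: spread_def\<close>)
  finally show ?thesis .
qed

text \<open>Passes from the product to the triple sum: for d = 2 and e = 3 the index set is N =
  n.\<close>

lemma spread_mult_nth_3:
  assumes "d > 0" "e > 0"
  shows "fps_nth (spread 1 u * spread d v * spread e w) n =
    (\<Sum>(i, j, k) | i + d * j + e * k = n. u i * v j * w k)"
proof -
  have fin: "finite {j. c * j \<le> m}" if "c > 0" for c m :: nat
  proof (rule finite_subset)
    have "j \<le> c * j" for j using that by (cases c) simp_all
    then show "{j. c * j \<le> m} \<subseteq> {..m}" using order_trans by blast
  qed simp
  have "fps_nth (spread 1 u * spread d v * spread e w) n =
    (\<Sum>k | e * k \<le> n. \<Sum>j | d * j \<le> n - e * k. u (n - e * k - d * j) * v j * w k)"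
    using assms by (simp add: mult_spread_nth sum_distrib_right)
  also have "\<dots> = (\<Sum>(k, j)\<in>(SIGMA k:{k. e * k \<le> n}. {j. d * j \<le> n - e * k}).
      u (n - e * k - d * j) * v j * w k)"
    using fin assms by (subst sum.Sigma) auto
  also have "\<dots> = (\<Sum>(i, j, k) | i + d * j + e * k = n. u i * v j * w k)"
    \<comment> \<open>The index i is determined by j and k, whose bounds make the natural
      subtractions exact.\<close>
    by (rule sum.reindex_bij_witness[where i = "\<lambda>(i, j, k). (k, j)"
          and j = "\<lambda>(k, j). (n - e * k - d * j, j, k)"]) auto
  finally show ?thesis .
qed

text \<open>The hypothesis is the comparison of coefficients at x^(d (j + 1)) in S(x) = S(c x) + a
  x^d S(s x). At exponents not divisible by d both sides vanish, and at x^0 they agree because d >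
  0.\<close>

lemma spread_shift_eq:
  assumes "d > 0" "\<And>j. u (Suc j) * (1 - c ^ (d * Suc j)) = a * s ^ (d * j) * u j"
  shows "spread d u = dilate c (spread d u) + fps_const a * fps_X ^ d * dilate s (spread d u)"
proof (rule fps_ext)
  fix n
  show "fps_nth (spread d u) n =
    fps_nth (dilate c (spread d u) + fps_const a * fps_X ^ d * dilate s (spread d u)) n"
  proof (cases "d dvd n")
    case True
    then obtain m where m: "n = d * m" by blast
    show ?thesis
    proof (cases m)
      case 0
      then show ?thesis using m assms(1) by (simp add: spread_def mult.assoc fps_X_power_mult_nth)
    next
      case (Suc j)
      have "d * Suc j - d = d * j" by simp
      moreover have "u (Suc j) = c ^ (d * Suc j) * u (Suc j) + a * (s ^ (d * j) * u j)"
        using assms(2)[of j] by (simp add: algebra_simps del: mult_Suc_right)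
      ultimately show ?thesis using m Suc assms(1)
        by (simp add: spread_def mult.assoc fps_X_power_mult_nth del: mult_Suc_right)
    qed
  next
    case False
    then have "\<not> d dvd n - d" if "n \<ge> d"
      using that by (meson dvd_diffD dvd_refl)
    with False show ?thesis
      by (auto simp: spread_def mult.assoc fps_X_power_mult_nth)
  qed
qed


section \<open>The three Euler series\<close>

lemma inverse_qpoch_Suc:
  assumes "m > 0"
  shows "inverse (qpoch (q ^ m) (q ^ m) (Suc n)) * (1 - q ^ (m * Suc n)) =
    inverse (qpoch (q ^ m) (q ^ m) n)"
proof -
  have "qpoch (q ^ m) (q ^ m) (Suc n) = qpoch (q ^ m) (q ^ m) n * (1 - q ^ (m * Suc n))"
    by (simp add: qpoch_def power_add power_mult)
  moreover have "fps_nth (1 - q ^ (m * Suc n)) 0 \<noteq> 0"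
    using assms by (simp add: fps_X_power_nth)
  ultimately show ?thesis
    by (simp add: fps_inverse_mult mult.assoc inverse_mult_eq_1 del: mult_Suc_right)
qed

text \<open>By Euler, the coefficients of 1 / (x q; q)_infinity in powers of x.\<close>

definition euler1 :: "nat \<Rightarrow> rat fps" where
  "euler1 i = q ^ i * inverse (qpoch q q i)"

text \<open>The coefficients of 1 / (x^2 q^3; q^4)_infinity in powers of x^2.\<close>

definition euler2 :: "nat \<Rightarrow> rat fps" where
  "euler2 j = q ^ (3 * j) * inverse (qpoch (q ^ 4) (q ^ 4) j)"

text \<open>The coefficients of (x^3 q^6; q^6)_infinity in powers of x^3, by Euler's second
  identity.\<close>

definition euler3 :: "nat \<Rightarrow> rat fps" where
  "euler3 k = (-1) ^ k * q ^ (3 * k ^ 2 + 3 * k) * inverse (qpoch (q ^ 6) (q ^ 6) k)"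

lemma dilate_by_1 [simp]: "dilate 1 f = f"
  by (simp add: fps_eq_iff)

text \<open>One step x := x q removes the first factor 1 - x q of the denominator product;
  \<open>shift\<close> is two such steps.\<close>

lemma euler1_shift: "(1 - Q 1 * fps_X) * (1 - Q 2 * fps_X) * spread 1 euler1 = shift (spread 1 euler1)"
proof -
  \<comment> \<open>The base 1 in \<open>1 ^ (1 * j)\<close> is the s of
    \<open>spread_shift_eq\<close>: the last term is not dilated.\<close>
  have "euler1 (Suc j) * (1 - q ^ (1 * Suc j)) = q * 1 ^ (1 * j) * euler1 j" for j
    using inverse_qpoch_Suc[of 1 j] by (simp add: euler1_def mult.assoc)
  from spread_shift_eq[OF _ this]
  have 1: "(1 - Q 1 * fps_X) * spread 1 euler1 = dilate q (spread 1 euler1)"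
    by (simp add: algebra_simps)
  from arg_cong[OF this, of "dilate q"]
  have "(1 - Q 2 * fps_X) * dilate q (spread 1 euler1) = shift (spread 1 euler1)"
    by (simp add: shift_simps dilate_dilate power2_eq_square mult.assoc flip: fps_const_mult)
  with 1 show ?thesis by (metis mult.assoc mult.commute)
qed

text \<open>Here x := x q^2 turns x^2 into x^2 q^4, a single step in base q^4.\<close>

lemma euler2_shift: "(1 - Q 3 * fps_X ^ 2) * spread 2 euler2 = shift (spread 2 euler2)"
proof -
  have "(q ^ 2) ^ (2 * Suc j) = q ^ (4 * Suc j)" for j
    by (simp only: power_mult [symmetric] mult.assoc [symmetric]) (simp del: mult_Suc_right)
  then have "euler2 (Suc j) * (1 - (q ^ 2) ^ (2 * Suc j)) = q ^ 3 * 1 ^ (2 * j) * euler2 j" for j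
    using inverse_qpoch_Suc[of 4 j]
    by (simp only: euler2_def mult_Suc_right power_add mult.assoc power_one mult_1_left)
  from spread_shift_eq[OF _ this] show ?thesis by (simp add: algebra_simps)
qed

text \<open>The exponent 3 k^2 + 3 k grows by 6 k + 6, so besides a = -q^6 a factor (q^2)^(3 k)
  appears. Hence s = q^2 in \<open>spread_shift_eq\<close>, and the polynomial factor falls on the
  shifted side.\<close>

lemma euler3_shift: "spread 3 euler3 = (1 - Q 6 * fps_X ^ 3) * shift (spread 3 euler3)"
proof -
  have "euler3 (Suc k) * (1 - (q ^ 2) ^ (3 * Suc k)) = - (q ^ 6) * (q ^ 2) ^ (3 * k) * euler3 k" for k
  proof -
    have 1: "(q ^ 2) ^ (3 * Suc k) = q ^ (6 * Suc k)"
      by (simp only: power_mult [symmetric]) simp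
    have "3 * Suc k ^ 2 + 3 * Suc k = 6 + (2 * (3 * k) + (3 * k ^ 2 + 3 * k))"
      by (simp add: power2_eq_square)
    then have 2: "q ^ (3 * Suc k ^ 2 + 3 * Suc k) =
        q ^ 6 * ((q ^ 2) ^ (3 * k) * q ^ (3 * k ^ 2 + 3 * k))"
      by (simp only: power_add power_mult)
    have "euler3 (Suc k) * (1 - (q ^ 2) ^ (3 * Suc k)) = (-1) ^ Suc k * q ^ (3 * Suc k ^ 2 + 3 * Suc k) *
        (inverse (qpoch (q ^ 6) (q ^ 6) (Suc k)) * (1 - q ^ (6 * Suc k)))"
      unfolding euler3_def 1 by (simp only: mult.assoc)
    also have "\<dots> = (-1) ^ Suc k * (q ^ 6 * ((q ^ 2) ^ (3 * k) * q ^ (3 * k ^ 2 + 3 * k))) *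
        inverse (qpoch (q ^ 6) (q ^ 6) k)"
      by (subst inverse_qpoch_Suc) (simp_all only: 2)
    also have "\<dots> = - (q ^ 6) * (q ^ 2) ^ (3 * k) * euler3 k"
      unfolding euler3_def by (simp only: power_Suc mult_ac) simp
    finally show ?thesis .
  qed
  from spread_shift_eq[OF _ this] show ?thesis
    by (simp add: algebra_simps flip: fps_const_neg)
qed

text \<open>Difference of cubes; b = a^2 and c = a^3 are separate letters so that
  \<open>Q 2\<close>, \<open>Q 4\<close> and \<open>Q 6\<close> match as single constants.\<close>

lemma one_minus_cube:
  fixes a :: "'a::comm_ring_1"
  assumes "a * b = c" "a * a = b"
  shows "1 - c * x ^ 3 = (1 - a * x) * (1 + a * x + b * x ^ 2)"
  unfolding assms(1)[symmetric] assms(2)[symmetric]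
  by (simp add: algebra_simps power2_eq_square power3_eq_cube)

text \<open>The series H(x), as an infinite product (x^3 q^6; q^6)_infinity / ((x q; q)_infinity
  (x^2 q^3; q^4)_infinity).\<close>

definition product :: "rat fps fps" where
  "product = spread 1 euler1 * spread 2 euler2 * spread 3 euler3"

lemma fun_eq_twist_product: "fun_eq (twist product)"
proof (rule fun_eq_twist)
  have c: "Q 2 * Q 4 = Q 6" "Q 2 * Q 2 = Q 4"
    by (simp_all only: Q_mult) simp_all
  have "(1 - Q 2 * fps_X) * ((1 - Q 1 * fps_X) * (1 - Q 3 * fps_X ^ 2) * product) =
    ((1 - Q 1 * fps_X) * (1 - Q 2 * fps_X) * spread 1 euler1) *
    ((1 - Q 3 * fps_X ^ 2) * spread 2 euler2) * spread 3 euler3"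
    unfolding product_def by (simp only: mult_ac)
  also have "\<dots> = (1 - Q 6 * fps_X ^ 3) * shift product"
    unfolding euler1_shift euler2_shift
    by (subst euler3_shift) (simp only: product_def dilate_mult mult_ac)
  also have "\<dots> = (1 - Q 2 * fps_X) * ((1 + Q 2 * fps_X + Q 4 * fps_X ^ 2) * shift product)"
    by (simp only: one_minus_cube[OF c] mult.assoc)
  finally show "(1 - Q 1 * fps_X) * (1 - Q 3 * fps_X ^ 2) * product =
      (1 + Q 2 * fps_X + Q 4 * fps_X ^ 2) * shift product"
  \<comment> \<open>The ring is an integral domain and 1 - q^2 x has constant term 1, so this factor
    can be cancelled.\<close>
  proof (subst (asm) mult_cancel_left, elim disjE)
    assume "1 - Q 2 * fps_X = 0"
    then have "fps_nth (1 - Q 2 * fps_X) 0 = 0" by simp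
    then show ?thesis by simp
  qed
qed

section \<open>The partition side\<close>

text \<open>Sortedness and conditions (i) to (iii) checked at the front of the list, so that
  prefixing a part involves only the next two. An even \<open>a\<close> stands for 2j. Positivity is
  left to \<open>Good\<close>.\<close>

fun good :: "nat list \<Rightarrow> bool" where
  "good [] = True"
| "good [a] = True"
| "good (a # b # \<pi>) \<longleftrightarrow> a < b \<and> \<not> (even b \<and> b = a + 1) \<and> good (b # \<pi>) \<and>
     (case \<pi> of [] \<Rightarrow> True | c # _ \<Rightarrow> even a \<longrightarrow>
        \<not> (b = a + 1 \<and> c = a + 3) \<and> \<not> (b = a + 2 \<and> (c = a + 3 \<or> c = a + 4)))"

text \<open>An occurrence begins at the head or lies in the tail. At the head 2j = a over the
  integers, which says that a is even.\<close>

lemma sublist_triple_iff: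
  "(\<exists>j::int. sublist [2 * j, 2 * j + int r, 2 * j + int s] (map int (a # b # \<pi>))) \<longleftrightarrow>
     even a \<and> b = a + r \<and> (\<exists>\<rho>. \<pi> = (a + s) # \<rho>) \<or>
     (\<exists>j::int. sublist [2 * j, 2 * j + int r, 2 * j + int s] (map int (b # \<pi>)))"
proof -
  have "(\<exists>j::int. prefix [2 * j, 2 * j + int r, 2 * j + int s] (map int (a # b # \<pi>))) \<longleftrightarrow>
     even a \<and> b = a + r \<and> (\<exists>\<rho>. \<pi> = (a + s) # \<rho>)" (is "?L \<longleftrightarrow> ?R")
  proof
    assume ?L
    then obtain j :: int where "prefix [2 * j, 2 * j + int r, 2 * j + int s] (map int (a # b # \<pi>))" ..
    then have j: "2 * j = int a" "int a + int r = int b" "prefix [int a + int s] (map int \<pi>)"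
      by auto
    then have "even a" by presburger
    with j show ?R by (cases \<pi>) (auto simp flip: of_nat_add)
  next
    assume ?R
    then obtain m \<rho> where "a = 2 * m" "b = a + r" "\<pi> = (a + s) # \<rho>" by auto
    then have "prefix [2 * int m, 2 * int m + int r, 2 * int m + int s] (map int (a # b # \<pi>))"
      by simp
    then show ?L ..
  qed
  then show ?thesis
    by (simp only: list.map sublist_Cons_right[of _ "int a" "int b # map int \<pi>"] ex_disj_distrib)
qed

lemma good_iff:
  "good \<pi> \<longleftrightarrow> sorted \<pi> \<and> distinct \<pi> \<and> (\<forall>a b. sublist [a, b] \<pi> \<and> even b \<longrightarrow> b \<noteq> a + 1) \<and>
     \<not> (\<exists>j::int. sublist [2 * j, 2 * j + int 1, 2 * j + int 3] (map int \<pi>)) \<and>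
     \<not> (\<exists>j::int. sublist [2 * j, 2 * j + int 2, 2 * j + int 3] (map int \<pi>)) \<and>
     \<not> (\<exists>j::int. sublist [2 * j, 2 * j + int 2, 2 * j + int 4] (map int \<pi>))"
proof (induction \<pi> rule: good.induct)
  case (3 a b \<pi>)
  have pair: "(\<forall>c d. sublist [c, d] (a # b # \<pi>) \<and> even d \<longrightarrow> d \<noteq> c + 1) \<longleftrightarrow>
      \<not> (even b \<and> b = a + 1) \<and> (\<forall>c d. sublist [c, d] (b # \<pi>) \<and> even d \<longrightarrow> d \<noteq> c + 1)"
    by (subst (1) sublist_Cons_right) auto
  have sort: "sorted (a # b # \<pi>) \<and> distinct (a # b # \<pi>) \<longleftrightarrow> a < b \<and> sorted (b # \<pi>) \<and> distinct (b # \<pi>)"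
    by auto
  have triple: "(case \<pi> of [] \<Rightarrow> True | c # _ \<Rightarrow> even a \<longrightarrow>
        \<not> (b = a + 1 \<and> c = a + 3) \<and> \<not> (b = a + 2 \<and> (c = a + 3 \<or> c = a + 4))) \<longleftrightarrow>
      \<not> (even a \<and> b = a + 1 \<and> (\<exists>\<rho>. \<pi> = (a + 3) # \<rho>)) \<and>
      \<not> (even a \<and> b = a + 2 \<and> (\<exists>\<rho>. \<pi> = (a + 3) # \<rho>)) \<and>
      \<not> (even a \<and> b = a + 2 \<and> (\<exists>\<rho>. \<pi> = (a + 4) # \<rho>))"
    by (cases \<pi>) auto
  show ?case
    unfolding good.simps(3) "3.IH" sublist_triple_iff pair triple using sort by argo
qed (auto simp: sublist_Cons_right)

text \<open>The series f and g are \<open>gf (Good 1)\<close> and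
  \<open>gf (Good 2)\<close>.\<close>

definition Good :: "nat \<Rightarrow> nat list set" where
  "Good k = {\<pi>. good \<pi> \<and> (\<forall>p\<in>set \<pi>. k \<le> p)}"

lemma partitions_P_eq: "partitions_P = Good 1"
  unfolding partitions_P_def Good_def is_partition_def good_iff by auto

text \<open>Good lists increase, so the lower bound need only be checked on the first part.\<close>

lemma mem_Good_iff: "\<pi> \<in> Good k \<longleftrightarrow> good \<pi> \<and> (\<pi> = [] \<or> k \<le> hd \<pi>)"
proof (cases \<pi>)
  case (Cons a \<rho>)
  then have "sorted (a # \<rho>)" if "good \<pi>" using that good_iff[of \<pi>] by simp
  with Cons show ?thesis by (fastforce simp: Good_def)
qed (simp add: Good_def)

section \<open>Removing the smallest part\<close>

lemma Good_split: "Good k = Good (Suc k) \<union> (#) k ` {\<pi>. good (k # \<pi>)}"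
proof (rule set_eqI)
  fix \<pi>
  have "\<pi> \<in> (#) k ` {\<pi>. good (k # \<pi>)} \<longleftrightarrow> \<pi> \<noteq> [] \<and> hd \<pi> = k \<and> good \<pi>"
    by (cases \<pi>) auto
  moreover have "k \<le> hd \<pi> \<longleftrightarrow> Suc k \<le> hd \<pi> \<or> hd \<pi> = k" by linarith
  ultimately show "\<pi> \<in> Good k \<longleftrightarrow> \<pi> \<in> Good (Suc k) \<union> (#) k ` {\<pi>. good (k # \<pi>)}"
    unfolding Un_iff mem_Good_iff by (metis good.simps(1))
qed

text \<open>After an odd k the part k + 1 is even and excluded by (ii), while every pattern of (iii)
  starts with an even part.\<close>

lemma good_Cons_odd:
  assumes "odd k"
  shows "{\<pi>. good (k # \<pi>)} = Good (k + 2)"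
proof (rule set_eqI)
  have "good (k # c # \<rho>) \<longleftrightarrow> k + 2 \<le> c \<and> good (c # \<rho>)" for c \<rho>
  proof -
    have "k < c \<and> \<not> (even c \<and> c = k + 1) \<longleftrightarrow> k + 2 \<le> c"
      using assms by (cases "c = k + 1") auto
    moreover have "good (k # c # \<rho>) \<longleftrightarrow> (k < c \<and> \<not> (even c \<and> c = k + 1)) \<and> good (c # \<rho>)"
      unfolding good.simps(3) using assms by (simp split: list.split)
    ultimately show ?thesis by blast
  qed
  then show "\<pi> \<in> {\<pi>. good (k # \<pi>)} \<longleftrightarrow> \<pi> \<in> Good (k + 2)" for \<pi>
    by (cases \<pi>) (auto simp: mem_Good_iff simp del: good.simps(3))
qed

lemma good_Cons_imp: "good (a # \<pi>) \<Longrightarrow> \<pi> \<in> Good (a + 1)"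
  by (cases \<pi>) (simp_all add: mem_Good_iff)

text \<open>Every forbidden configuration has its second part within 2 of the first.\<close>

lemma good_Cons_gap: "\<pi> \<in> Good (a + 3) \<Longrightarrow> good (a # \<pi>)"
  by (cases \<pi>) (auto simp: mem_Good_iff split: list.split)

text \<open>The next part may be k + 1, which is odd; then (ii) excludes k + 2 as third part and the
  first pattern of (iii) excludes k + 3. It may be k + 2; then the other two patterns exclude k + 3
  and k + 4, and a gap of at least 3 remains. From k + 3 on, k imposes nothing.\<close>

lemma good_Cons_even:
  assumes "even k"
  shows "{\<pi>. good (k # \<pi>)} = Good (k + 3) \<union> (#) (k + 1) ` Good (k + 4) \<union> (#) (k + 2) ` Good (k + 5)"
proof (rule set_eqI)
  have one: "good (k # (k + 1) # \<rho>) \<longleftrightarrow> \<rho> \<in> Good (k + 4)" for \<rho>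
  proof -
    have "good (k # (k + 1) # \<rho>) \<longleftrightarrow>
        good ((k + 1) # \<rho>) \<and> (case \<rho> of [] \<Rightarrow> True | c # _ \<Rightarrow> c \<noteq> k + 3)"
      unfolding good.simps(3) using assms by (simp split: list.split)
    also have "good ((k + 1) # \<rho>) \<longleftrightarrow> \<rho> \<in> Good (k + 3)"
    proof -
      have "\<rho> \<in> {\<rho>. good ((k + 1) # \<rho>)} \<longleftrightarrow> \<rho> \<in> Good (k + 1 + 2)"
        by (subst good_Cons_odd) (use assms in simp_all)
      moreover have "k + 1 + 2 = k + 3" by simp
      ultimately show ?thesis by (simp only: mem_Collect_eq)
    qed
    finally show ?thesis by (cases \<rho>) (auto simp: mem_Good_iff)
  qed
  have two: "good (k # (k + 2) # \<rho>) \<longleftrightarrow> \<rho> \<in> Good (k + 5)" for \<rho>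
  proof -
    have "good (k # (k + 2) # \<rho>) \<longleftrightarrow>
        good ((k + 2) # \<rho>) \<and> (case \<rho> of [] \<Rightarrow> True | c # _ \<Rightarrow> c \<noteq> k + 3 \<and> c \<noteq> k + 4)"
      unfolding good.simps(3) using assms by (simp split: list.split)
    also have "\<dots> \<longleftrightarrow> \<rho> \<in> Good (k + 5)"
    proof
      assume *: "good ((k + 2) # \<rho>) \<and> (case \<rho> of [] \<Rightarrow> True | c # _ \<Rightarrow> c \<noteq> k + 3 \<and> c \<noteq> k + 4)"
      then have "\<rho> \<in> Good (k + 2 + 1)" using good_Cons_imp by blast
      with * show "\<rho> \<in> Good (k + 5)" by (cases \<rho>) (simp_all add: mem_Good_iff)
    next
      assume *: "\<rho> \<in> Good (k + 5)"
      moreover have "k + 5 = (k + 2) + 3" by simp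
      ultimately have "good ((k + 2) # \<rho>)" by (intro good_Cons_gap) (simp only:)
      with * show "good ((k + 2) # \<rho>) \<and> (case \<rho> of [] \<Rightarrow> True | c # _ \<Rightarrow> c \<noteq> k + 3 \<and> c \<noteq> k + 4)"
        by (cases \<rho>) (simp_all add: mem_Good_iff)
    qed
    finally show ?thesis .
  qed
  have large: "good (k # b # \<rho>) \<longleftrightarrow> k + 3 \<le> b \<and> good (b # \<rho>)" if "b \<noteq> k + 1" "b \<noteq> k + 2" for b \<rho>
  proof (cases "k + 3 \<le> b")
    case True
    then show ?thesis unfolding good.simps(3) by (simp split: list.split)
  next
    case False
    with that have "b \<le> k" by linarith
    with False show ?thesis unfolding good.simps(3) by simp
  qed
  show "\<pi> \<in> {\<pi>. good (k # \<pi>)} \<longleftrightarrow>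
      \<pi> \<in> Good (k + 3) \<union> (#) (k + 1) ` Good (k + 4) \<union> (#) (k + 2) ` Good (k + 5)" for \<pi>
  proof (cases \<pi>)
    case Nil
    then show ?thesis by (simp add: mem_Good_iff)
  next
    case (Cons b \<rho>)
    have "good (k # \<pi>) \<longleftrightarrow> k + 3 \<le> b \<and> good \<pi> \<or> b = k + 1 \<and> \<rho> \<in> Good (k + 4) \<or>
        b = k + 2 \<and> \<rho> \<in> Good (k + 5)"
      unfolding Cons using one two large
      by (cases "b = k + 1"; cases "b = k + 2") (simp_all del: good.simps)
    moreover have "\<pi> \<in> Good (k + 3) \<longleftrightarrow> k + 3 \<le> b \<and> good \<pi>"
      using Cons by (auto simp: mem_Good_iff simp del: good.simps)
    moreover have "\<pi> \<in> (#) c ` S \<longleftrightarrow> b = c \<and> \<rho> \<in> S" for c S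
      using Cons by auto
    ultimately show ?thesis by (simp only: Un_iff mem_Collect_eq) blast
  qed
qed

text \<open>Only parities and differences of parts enter the conditions.\<close>

lemma good_map_add2: "good (map ((+) 2) \<pi>) \<longleftrightarrow> good \<pi>"
proof (induction \<pi> rule: good.induct)
  case (3 a b \<pi>)
  then show ?case by (cases \<pi>) (simp_all del: good.simps(3) add: good.simps(3)[of a] good.simps(3)[of "Suc (Suc a)"] add.commute)
qed simp_all

lemma Good_add2: "Good (k + 2) = map ((+) 2) ` Good k"
proof
  show "map ((+) 2) ` Good k \<subseteq> Good (k + 2)"
    by (auto simp: Good_def good_map_add2)
  show "Good (k + 2) \<subseteq> map ((+) 2) ` Good k"
  proof
    fix \<pi> assume \<pi>: "\<pi> \<in> Good (k + 2)"
    \<comment> \<open>The subtraction \<open>p - 2\<close> is exact, every part being at least k +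
      2.\<close>
    then have "\<pi> = map ((+) 2) (map (\<lambda>p. p - 2) \<pi>)"
      by (auto simp: Good_def intro!: map_idI [symmetric])
    moreover from this \<pi> have "map (\<lambda>p. p - 2) \<pi> \<in> Good k"
      using good_map_add2[of "map (\<lambda>p. p - 2) \<pi>"] by (auto simp: Good_def)
    ultimately show "\<pi> \<in> map ((+) 2) ` Good k" by blast
  qed
qed

section \<open>Generating functions of sets of partitions\<close>

definition gf :: "nat list set \<Rightarrow> rat fps fps" where
  "gf S = Abs_fps (\<lambda>n. Abs_fps (\<lambda>m. of_nat (card {\<pi>\<in>S. length \<pi> = n \<and> sum_list \<pi> = m})))"

text \<open>Length and sum are both fixed because lists over the naturals may contain zeros, and a
  fixed sum alone would leave infinitely many.\<close>

lemma finite_length_sum_list: "finite {\<pi>::nat list. length \<pi> = n \<and> sum_list \<pi> = m}"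
proof (rule finite_subset)
  show "{\<pi>::nat list. length \<pi> = n \<and> sum_list \<pi> = m} \<subseteq> {\<pi>. set \<pi> \<subseteq> {..m} \<and> length \<pi> = n}"
    using member_le_sum_list by fastforce
qed (simp add: finite_lists_length_eq)

lemma finite_gf_set [simp]: "finite {\<pi>\<in>S. length \<pi> = n \<and> sum_list \<pi> = (m::nat)}"
  by (rule finite_subset[OF _ finite_length_sum_list[of n m]]) auto

lemma gf_Un:
  assumes "S \<inter> T = {}"
  shows "gf (S \<union> T) = gf S + gf T"
proof -
  have "card {\<pi>\<in>S \<union> T. length \<pi> = n \<and> sum_list \<pi> = m} =
    card {\<pi>\<in>S. length \<pi> = n \<and> sum_list \<pi> = m} + card {\<pi>\<in>T. length \<pi> = n \<and> sum_list \<pi> = m}" for n m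
    using assms by (subst card_Un_disjoint [symmetric]) (auto intro!: arg_cong[of _ _ card])
  then show ?thesis by (simp add: gf_def fps_eq_iff)
qed

lemma gf_Cons: "gf ((#) a ` S) = fps_X * Q a * gf S"
proof -
  have "fps_nth (fps_nth (gf ((#) a ` S)) n) m = fps_nth (fps_nth (fps_X * (Q a * gf S)) n) m" for n m
  proof (cases "n > 0 \<and> a \<le> m")
    case True
    then have "{\<pi> \<in> (#) a ` S. length \<pi> = n \<and> sum_list \<pi> = m} =
        (#) a ` {\<pi>\<in>S. length \<pi> = n - 1 \<and> sum_list \<pi> = m - a}" by auto
    with True show ?thesis by (simp add: gf_def fps_X_power_mult_nth card_image)
  next
    case False
    then have "{\<pi> \<in> (#) a ` S. length \<pi> = n \<and> sum_list \<pi> = m} = {}" by auto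
    with False show ?thesis by (auto simp: gf_def fps_X_power_mult_nth)
  qed
  then show ?thesis by (simp add: fps_eq_iff mult.assoc)
qed

text \<open>Adding c to each of n parts raises the sum by c n, which amounts to x := x q^c.\<close>

lemma gf_map_add: "gf (map ((+) c) ` S) = dilate (q ^ c) (gf S)"
proof -
  have sum: "sum_list (map ((+) c) \<pi>) = c * length \<pi> + sum_list \<pi>" for \<pi>
    by (induction \<pi>) simp_all
  have "fps_nth (fps_nth (gf (map ((+) c) ` S)) n) m = fps_nth (fps_nth (dilate (q ^ c) (gf S)) n) m" for n m
  proof (cases "c * n \<le> m")
    case True
    then have "{\<pi> \<in> map ((+) c) ` S. length \<pi> = n \<and> sum_list \<pi> = m} =
        map ((+) c) ` {\<pi>\<in>S. length \<pi> = n \<and> sum_list \<pi> = m - c * n}" by (auto simp: sum)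
    moreover have "inj_on (map ((+) c)) A" for A
      by (auto intro!: inj_onI)
    ultimately show ?thesis using True
      by (simp add: gf_def fps_X_power_mult_nth card_image flip: power_mult)
  next
    case False
    then have "{\<pi> \<in> map ((+) c) ` S. length \<pi> = n \<and> sum_list \<pi> = m} = {}" by (auto simp: sum)
    with False show ?thesis by (auto simp: gf_def fps_X_power_mult_nth simp flip: power_mult)
  qed
  then show ?thesis by (simp add: fps_eq_iff)
qed

section \<open>The equations for f and g\<close>

lemma gf_Good_add2: "gf (Good (k + 2)) = shift (gf (Good k))"
  by (simp only: Good_add2 gf_map_add)

lemma gf_Good_1: "gf (Good 1) = gf (Good 2) + fps_X * Q 1 * shift (gf (Good 1))"
proof -
  have "Good 1 = Good 2 \<union> (#) 1 ` Good 3"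
    using Good_split[of 1] good_Cons_odd[of 1] by (simp add: numeral_eq_Suc)
  moreover have "Good 2 \<inter> (#) 1 ` Good 3 = {}"
    by (auto simp: mem_Good_iff)
  ultimately have "gf (Good 1) = gf (Good 2) + fps_X * Q 1 * gf (Good 3)"
    by (simp only: gf_Un gf_Cons)
  moreover have "gf (Good 3) = shift (gf (Good 1))"
    by (simp flip: gf_Good_add2 add: numeral_3_eq_3)
  ultimately show ?thesis by simp
qed

text \<open>\<open>Good 5\<close> follows a first part 3, or a first part 2 with neither 3 nor 4
  after it, whence q^2 + q^3. The coefficients q^5 and q^6 come from the beginnings 2 + 3 and 2 +
  4.\<close>

lemma gf_Good_2:
  "gf (Good 2) = shift (gf (Good 2)) + fps_X * (Q 2 + Q 3) * shift (shift (gf (Good 1))) +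
     fps_X ^ 2 * Q 5 * shift (shift (gf (Good 2))) + fps_X ^ 2 * Q 6 * shift (shift (shift (gf (Good 1))))"
proof -
  \<comment> \<open>\<open>B\<close> is the set of tails after a first part 2.\<close>
  define B where "B = Good 5 \<union> (#) 3 ` Good 6 \<union> (#) 4 ` Good 7"
  have eq: "Good 2 = Good 4 \<union> (#) 3 ` Good 5 \<union> (#) 2 ` B"
    using Good_split[of 2] good_Cons_even[of 2] Good_split[of 3] good_Cons_odd[of 3]
    by (simp add: B_def)
  have B: "gf B = gf (Good 5) + fps_X * Q 3 * gf (Good 6) + fps_X * Q 4 * gf (Good 7)"
    unfolding B_def by (subst gf_Un, force simp: mem_Good_iff)+ (simp only: gf_Cons)
  have "gf (Good 2) = gf (Good 4) + fps_X * Q 3 * gf (Good 5) + fps_X * Q 2 * gf B"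
    unfolding eq by (subst gf_Un, force simp: mem_Good_iff)+ (simp only: gf_Cons)
  moreover have "Q 2 * Q 3 = Q 5" "Q 2 * Q 4 = Q 6"
    by (simp_all only: Q_mult) simp_all
  moreover have "gf (Good 4) = shift (gf (Good 2))" "gf (Good 5) = shift (shift (gf (Good 1)))"
    "gf (Good 6) = shift (shift (gf (Good 2)))" "gf (Good 7) = shift (shift (shift (gf (Good 1))))"
    by (simp_all flip: gf_Good_add2) (simp_all add: eval_nat_numeral)
  ultimately show ?thesis unfolding B by algebra
qed

text \<open>Substitute g(x) = f(x) - x q f(x q^2) and its two shifts into the equation for g; the
  terms x q^3 f(x q^4) cancel.\<close>

lemma fun_eq_gf: "fun_eq (gf (Good 1))"
proof -
  define f where "f = gf (Good 1)"
  define g where "g = gf (Good 2)"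
  have f: "f = g + fps_X * Q 1 * shift f"
    unfolding f_def g_def by (rule gf_Good_1)
  have sf: "shift f = shift g + Q 2 * fps_X * Q 1 * shift (shift f)"
    using arg_cong[OF f, of shift] by (simp only: shift_simps dilate_const dilate_X)
  have ssf: "shift (shift f) = shift (shift g) + Q 2 * (Q 2 * fps_X) * Q 1 * shift (shift (shift f))"
    using arg_cong[OF sf, of shift] by (simp only: shift_simps dilate_const dilate_X)
  have g: "g = shift g + fps_X * (Q 2 + Q 3) * shift (shift f) +
     fps_X ^ 2 * Q 5 * shift (shift g) + fps_X ^ 2 * Q 6 * shift (shift (shift f))"
    unfolding f_def g_def by (rule gf_Good_2)
  have c: "Q 2 * Q 1 = Q 3" "Q 2 * (Q 2 * (Q 1 * Q 5)) = Q 10"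
    by (simp_all only: Q_mult) simp_all
  show ?thesis
    unfolding fun_eq_def f_def [symmetric] using f sf ssf g c by algebra
qed

lemma gf_eq_twist_product: "gf (Good 1) = twist product"
proof (rule fun_eq_unique[OF fun_eq_gf fun_eq_twist_product])
  have "{\<pi> \<in> Good 1. length \<pi> = 0 \<and> sum_list \<pi> = m} = (if m = 0 then {[]} else {})" for m
    by (auto simp: mem_Good_iff)
  then have "fps_nth (gf (Good 1)) 0 = 1"
    by (simp add: gf_def fps_eq_iff)
  moreover have "fps_nth (twist product) 0 = 1"
    by (simp add: twist_def product_def spread_def euler1_def euler2_def euler3_def qpoch_def)
  ultimately show "fps_nth (gf (Good 1)) 0 = fps_nth (twist product) 0" by simp
qed


section \<open>Convergence\<close>

text \<open>Convergence of power series follows once each coefficient is eventually constant, and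
  the m-th one is as soon as X contains its finite support.\<close>

lemma has_sum_fpsI:
  fixes f :: "'b \<Rightarrow> 'a::comm_ring_1 fps"
  assumes fin: "\<And>m. finite {a\<in>A. fps_nth (f a) m \<noteq> 0}"
    and sum: "\<And>m. (\<Sum>a | a \<in> A \<and> fps_nth (f a) m \<noteq> 0. fps_nth (f a) m) = fps_nth F m"
  shows "(f has_sum F) A"
  unfolding has_sum_def
proof (rule tendsto_fpsI)
  fix m
  show "\<forall>\<^sub>F X in finite_subsets_at_top A. fps_nth (sum f X) m = fps_nth F m"
    unfolding eventually_finite_subsets_at_top
  proof (intro exI conjI allI impI)
    show "finite {a\<in>A. fps_nth (f a) m \<noteq> 0}" by (rule fin)
    fix X assume X: "finite X \<and> {a\<in>A. fps_nth (f a) m \<noteq> 0} \<subseteq> X \<and> X \<subseteq> A"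
    have "fps_nth (sum f X) m = (\<Sum>a\<in>X. fps_nth (f a) m)"
      by (rule fps_sum_nth)
    also have "\<dots> = (\<Sum>a | a \<in> A \<and> fps_nth (f a) m \<noteq> 0. fps_nth (f a) m)"
      using X by (intro sum.mono_neutral_right) auto
    finally show "fps_nth (sum f X) m = fps_nth F m" using sum by simp
  qed auto
qed

text \<open>Passes from x as outer variable, which suits the functional equation, to q as outer
  variable, as in \<open>xvar\<close> and \<open>qvar\<close>.\<close>

definition swap_vars :: "'a::zero fps fps \<Rightarrow> 'a fps fps" where
  "swap_vars f = Abs_fps (\<lambda>m. Abs_fps (\<lambda>n. fps_nth (fps_nth f n) m))"

lemma swap_vars_nth [simp]: "fps_nth (fps_nth (swap_vars f) m) n = fps_nth (fps_nth f n) m"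
  by (simp add: swap_vars_def)

lemma xvar_power_mult_nth: "fps_nth (xvar ^ n * f) m = fps_X ^ n * fps_nth f m"
  by (simp add: xvar_def fps_const_power)

lemma has_sum_partitions:
  "((\<lambda>\<pi>. xvar ^ length \<pi> * qvar ^ sum_list \<pi>) has_sum swap_vars (gf partitions_P)) partitions_P"
proof (rule has_sum_fpsI)
  have nth: "fps_nth (xvar ^ length \<pi> * qvar ^ sum_list \<pi>) m =
      (if sum_list \<pi> = m then fps_X ^ length \<pi> else 0)" for \<pi> m
    by (simp add: xvar_power_mult_nth qvar_def fps_X_power_nth)
  have support: "{\<pi>\<in>partitions_P. fps_nth (xvar ^ length \<pi> * qvar ^ sum_list \<pi>) m \<noteq> 0} =
      {\<pi>\<in>partitions_P. sum_list \<pi> = m}" for m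
    by (auto simp: nth)
  \<comment> \<open>Positivity bounds the length, so that the partitions of m are finite in
    number.\<close>
  have length_le: "length \<pi> \<le> sum_list \<pi>" if "\<forall>p\<in>set \<pi>. 0 < p" for \<pi> :: "nat list"
    using that by (induction \<pi>) auto
  have fin: "finite {\<pi>\<in>partitions_P. sum_list \<pi> = m}" for m
  proof (rule finite_subset)
    show "{\<pi>\<in>partitions_P. sum_list \<pi> = m} \<subseteq> {\<pi>. set \<pi> \<subseteq> {..m} \<and> length \<pi> \<le> m}"
      using length_le member_le_sum_list
      by (fastforce simp: partitions_P_def is_partition_def)
  qed (simp add: finite_lists_length_le)
  then show "finite {\<pi>\<in>partitions_P. fps_nth (xvar ^ length \<pi> * qvar ^ sum_list \<pi>) m \<noteq> 0}" for m
    by (simp only: support)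
  show "(\<Sum>\<pi> | \<pi> \<in> partitions_P \<and> fps_nth (xvar ^ length \<pi> * qvar ^ sum_list \<pi>) m \<noteq> 0.
      fps_nth (xvar ^ length \<pi> * qvar ^ sum_list \<pi>) m) = fps_nth (swap_vars (gf partitions_P)) m" for m
  proof (rule fps_ext)
    fix n
    have "fps_nth (\<Sum>\<pi> | \<pi> \<in> partitions_P \<and> sum_list \<pi> = m. fps_X ^ length \<pi> :: rat fps) n =
        (\<Sum>\<pi> | \<pi> \<in> partitions_P \<and> sum_list \<pi> = m. if length \<pi> = n then 1 else 0)"
      by (simp add: fps_sum_nth fps_X_power_nth eq_commute)
    also have "\<dots> = of_nat (card {\<pi>\<in>partitions_P. length \<pi> = n \<and> sum_list \<pi> = m})"
      using fin by (subst sum.If_cases) (auto intro!: arg_cong[of _ _ card])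
    finally show "fps_nth (\<Sum>\<pi> | \<pi> \<in> partitions_P \<and> fps_nth (xvar ^ length \<pi> * qvar ^ sum_list \<pi>) m \<noteq> 0.
      fps_nth (xvar ^ length \<pi> * qvar ^ sum_list \<pi>) m) n = fps_nth (fps_nth (swap_vars (gf partitions_P)) m) n"
      unfolding support unfolding nth by (simp add: gf_def)
  qed
qed

section \<open>Series in q alone and the terms of the triple sum\<close>

definition lift :: "rat fps \<Rightarrow> rat fps fps" where
  "lift f = Abs_fps (\<lambda>m. fps_const (fps_nth f m))"

lemma lift_nth [simp]: "fps_nth (lift f) m = fps_const (fps_nth f m)"
  by (simp add: lift_def)

lemma fps_const_sum: "fps_const (\<Sum>i\<in>A. f i) = (\<Sum>i\<in>A. fps_const (f i))"
  by (induction A rule: infinite_finite_induct) (simp_all flip: fps_const_add)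

lemma lift_mult: "lift (f * g) = lift f * lift g"
  by (rule fps_ext) (simp add: fps_mult_nth fps_const_sum)

lemma lift_1 [simp]: "lift 1 = 1"
  by (rule fps_ext) (simp add: fps_one_nth)

lemma lift_diff: "lift (f - g) = lift f - lift g"
  by (rule fps_ext) simp

lemma lift_minus_1: "lift (-1) = -1"
  by (rule fps_ext) (simp add: fps_one_nth flip: fps_const_neg)

lemma lift_power: "lift (f ^ n) = lift f ^ n"
  by (induction n) (simp_all add: lift_mult)

lemma lift_q: "lift q = qvar"
  by (rule fps_ext) (simp add: qvar_def fps_X_nth)

lemma lift_qpoch: "lift (qpoch a b n) = qpoch (lift a) (lift b) n"
  unfolding qpoch_def by (induction n) (simp_all add: lift_mult lift_diff lift_power)

definition summand :: "nat \<times> nat \<times> nat \<Rightarrow> rat fps" where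
  "summand = (\<lambda>(i, j, k). q ^ ((i + 2 * j + 3 * k) * (i + 2 * j + 3 * k - 1)) *
     (euler1 i * euler2 j * euler3 k))"

text \<open>The quotient is identified by multiplying back with the denominator
  \<open>lift D\<close>: its constant term is 1, so the division is exact and \<open>lift D\<close>
  can be cancelled.\<close>

lemma summand_eq:
  "(let N = i + 2 * j + 3 * k in
      (-1) ^ k * xvar ^ N * qvar ^ (N * (N - 1) + i + 3 * j + 3 * k ^ 2 + 3 * k) /
        (qpoch qvar qvar i * qpoch (qvar ^ 4) (qvar ^ 4) j * qpoch (qvar ^ 6) (qvar ^ 6) k)) =
    xvar ^ (i + 2 * j + 3 * k) * lift (summand (i, j, k))"
proof -
  define N where "N = i + 2 * j + 3 * k"
  define D where "D = qpoch q q i * qpoch (q ^ 4) (q ^ 4) j * qpoch (q ^ 6) (q ^ 6) k"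
  define n where "n = (-1) ^ k * q ^ (N * (N - 1) + i + 3 * j + 3 * k ^ 2 + 3 * k)"
  have D: "lift D = qpoch qvar qvar i * qpoch (qvar ^ 4) (qvar ^ 4) j * qpoch (qvar ^ 6) (qvar ^ 6) k"
    unfolding D_def by (simp only: lift_mult lift_qpoch lift_power lift_q)
  have D0: "fps_nth (lift D) 0 = 1"
    unfolding D using qpoch_nth_0[of 1] by (simp add: fps_mult_nth_0 qpoch_nth_0)
  then have D_unit: "fps_nth D 0 \<noteq> 0" by auto
  have "summand (i, j, k) = n * inverse D"
    unfolding summand_def n_def D_def euler1_def euler2_def euler3_def N_def prod.case
    by (simp only: fps_inverse_mult power_add mult_ac)
  then have "summand (i, j, k) * D = n"
    using inverse_mult_eq_1[OF D_unit] by (simp add: mult.assoc)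
  then have "xvar ^ N * lift (summand (i, j, k)) * lift D = xvar ^ N * lift n"
    by (simp add: mult.assoc flip: lift_mult)
  also have "\<dots> = xvar ^ N * lift n / lift D * lift D"
    using fps_divide_times_cancel[OF D0] by simp
  finally have "xvar ^ N * lift (summand (i, j, k)) = xvar ^ N * lift n / lift D"
    using D0 by (metis mult_cancel_right fps_zero_nth zero_neq_one)
  moreover have "xvar ^ N * lift n =
      (-1) ^ k * xvar ^ N * qvar ^ (N * (N - 1) + i + 3 * j + 3 * k ^ 2 + 3 * k)"
    unfolding n_def by (simp only: lift_mult lift_power lift_minus_1 lift_q mult_ac)
  ultimately show ?thesis
    unfolding Let_def N_def [symmetric] D [symmetric] by simp
qed

text \<open>From i + 3 j + 3 k^2 + 3 k \<ge> i + j + k the term is divisible by q^(i + j + k), so a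
  fixed power of q meets only finitely many triples.\<close>

lemma summand_nth_eq_0:
  assumes "m < i + j + k"
  shows "fps_nth (summand (i, j, k)) m = 0"
proof -
  have "summand (i, j, k) = q ^ (i + j + k) * (q ^ ((i + 2 * j + 3 * k) * (i + 2 * j + 3 * k - 1)) *
      q ^ (2 * j) * q ^ (3 * k ^ 2 + 2 * k) * (-1) ^ k * inverse (qpoch q q i) *
      inverse (qpoch (q ^ 4) (q ^ 4) j) * inverse (qpoch (q ^ 6) (q ^ 6) k))"
  proof -
    have "3 * j = j + 2 * j" "3 * k ^ 2 + 3 * k = k + (3 * k ^ 2 + 2 * k)" by simp_all
    then have "q ^ (3 * j) = q ^ j * q ^ (2 * j)"
      "q ^ (3 * k ^ 2 + 3 * k) = q ^ k * q ^ (3 * k ^ 2 + 2 * k)"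
      by (simp_all only: power_add)
    moreover have "q ^ (i + j + k) = q ^ i * q ^ j * q ^ k"
      by (simp only: power_add)
    ultimately show ?thesis
      unfolding summand_def euler1_def euler2_def euler3_def prod.case by (simp only: mult_ac)
  qed
  with assms show ?thesis by (simp add: fps_X_power_mult_nth)
qed

text \<open>At x^n only triples with N = n count, so q^(N (N - 1)) is a common factor, the one
  inserted by \<open>twist\<close>; what remains is the coefficient of \<open>product\<close> at
  x^n.\<close>

lemma has_sum_series:
  "((\<lambda>(i, j, k). xvar ^ (i + 2 * j + 3 * k) * lift (summand (i, j, k))) has_sum
     swap_vars (twist product)) UNIV"
proof (rule has_sum_fpsI)
  fix m
  let ?f = "\<lambda>(i, j, k). xvar ^ (i + 2 * j + 3 * k) * lift (summand (i, j, k))"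
  let ?S = "{t \<in> UNIV. fps_nth (?f t) m \<noteq> 0}"
  have nth: "fps_nth (?f (i, j, k)) m = fps_X ^ (i + 2 * j + 3 * k) * fps_const (fps_nth (summand (i, j, k)) m)"
    for i j k by (simp add: xvar_power_mult_nth)
  have "?S \<subseteq> {..m} \<times> {..m} \<times> {..m}"
  proof
    fix t assume "t \<in> ?S"
    then obtain i j k where t: "t = (i, j, k)" and "fps_nth (summand (i, j, k)) m \<noteq> 0"
      using nth by (cases t) auto
    then have "i + j + k \<le> m" using summand_nth_eq_0 not_less by blast
    then show "t \<in> {..m} \<times> {..m} \<times> {..m}" by (simp add: t)
  qed
  then show fin: "finite ?S" by (rule finite_subset) simp
  show "(\<Sum>t | t \<in> UNIV \<and> fps_nth (?f t) m \<noteq> 0. fps_nth (?f t) m) = fps_nth (swap_vars (twist product)) m"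
  proof (rule fps_ext)
    fix n
    let ?T = "{(i::nat, j, k). i + 2 * j + 3 * k = n}"
    have finT: "finite ?T"
      by (rule finite_subset[of _ "{..n} \<times> {..n} \<times> {..n}"]) auto
    have nth': "fps_nth (fps_nth (?f t) m) n = (if t \<in> ?T then fps_nth (summand t) m else 0)" for t
      by (cases t) (simp add: xvar_power_mult_nth fps_X_power_nth eq_commute)
    have "fps_nth (\<Sum>t\<in>?S. fps_nth (?f t) m) n = (\<Sum>t\<in>?S. if t \<in> ?T then fps_nth (summand t) m else 0)"
      unfolding fps_sum_nth nth' ..
    also have "\<dots> = (\<Sum>t\<in>?S \<inter> ?T. fps_nth (summand t) m)"
      using fin by (simp only: sum.inter_restrict)
    also have "\<dots> = (\<Sum>t\<in>?T. fps_nth (summand t) m)"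
    proof (rule sum.mono_neutral_left[OF finT])
      show "\<forall>t\<in>?T - ?S \<inter> ?T. fps_nth (summand t) m = 0"
      proof
        fix t assume "t \<in> ?T - ?S \<inter> ?T"
        then have t: "t \<in> ?T" "fps_nth (?f t) m = 0" by blast+
        then have "fps_nth (fps_nth (?f t) m) n = 0" by (simp only: fps_zero_nth)
        with t(1) show "fps_nth (summand t) m = 0" unfolding nth' by (simp only: if_True)
      qed
    qed auto
    also have "\<dots> = fps_nth (\<Sum>t\<in>?T. q ^ (n * (n - 1)) * (case t of (i, j, k) \<Rightarrow> euler1 i * euler2 j * euler3 k)) m"
      unfolding fps_sum_nth by (rule sum.cong[OF refl]) (auto simp: summand_def)
    also have "\<dots> = fps_nth (fps_nth (twist product) n) m"
      unfolding twist_def product_def fps_nth_Abs_fps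
      by (subst spread_mult_nth_3) (simp_all add: sum_distrib_left)
    finally show "fps_nth (\<Sum>t | t \<in> UNIV \<and> fps_nth (?f t) m \<noteq> 0. fps_nth (?f t) m) n =
        fps_nth (fps_nth (swap_vars (twist product)) m) n"
      by simp
  qed
qed

theorem mainTheorem2:
  "\<exists>F :: rat fps fps.
     ((\<lambda>\<pi>. xvar ^ length \<pi> * qvar ^ sum_list \<pi>) has_sum F) partitions_P \<and>
     ((\<lambda>(i, j, k). let N = i + 2 * j + 3 * k in
         (-1) ^ k * xvar ^ N * qvar ^ (N * (N - 1) + i + 3 * j + 3 * k ^ 2 + 3 * k) /
           (qpoch qvar qvar i * qpoch (qvar ^ 4) (qvar ^ 4) j * qpoch (qvar ^ 6) (qvar ^ 6) k))
       has_sum F) (UNIV :: (nat \<times> nat \<times> nat) set)"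
  unfolding summand_eq
  \<comment> \<open>The common value is \<open>swap_vars (gf partitions_P)\<close>.\<close>
  using has_sum_partitions has_sum_series gf_eq_twist_product partitions_P_eq by auto

end
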